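(* Let $p\in(0,1)$. Suppose that $F\in \mathcal{F}^{-}_{1}$, and let $F_1,F_2,\ldots \in \mathcal{F}^{-}_{1}$ be any sequence of (possibly random) cdf's that are unbiased estimators of $F$, that is, $\mathbb{E}( F_n(x) ) =F(x)$ for all $x\in \mathbb{R}$ and $n\in \mathbb{N}$, and such that $\mathbb{E}( F_n^{-1}(p) ) \in \mathbb{R}$ for all $n\in \mathbb{N}$. Then $\int_0^p F_n^{-1}(u)\,du$ is a non-negatively biased estimator of $\int_0^p F^{-1}(u)\,du$, that is, for every $n\in\mathbb{N}$, $$\mathbb{E}\bigg(\int_0^p F_n^{-1}(u)\,du\bigg)-\int_0^p F^{-1}(u)\,du\ge 0 .$$
   Context: The quantile function of a cdf $F$ is $F^{-1}(u)=\inf\{x\in\mathbb{R}: F(x)\ge u\}$ for $u\in(0,1]$ and $F^{-1}(0)=\lim_{u\downarrow 0}F^{-1}(u)$. The class $\mathcal{F}^{-}_{1}$ consists of all (deterministic) cdf's $F$ for which $\int_0^p F^{-1}(u)\,du$ is finite (for $p\in(0,1)$); equivalently, $\mathbb{E}(X^{-})<\infty$ for $X\sim F$, where $X^{-}=(-X)\vee 0$. The cdf $F$ is deterministic. The $F_n$ may be random: on an underlying probability space $(\Omega,\mathcal{A},\mathbb{P})$, $F_n:\Omega\times\mathbb{R}\to[0,1]$ is jointly measurable and $F_n(\omega,\cdot)$ is a cdf for almost all $\omega$; $F_n\in\mathcal{F}^{-}_{1}$ means that $F_n(\omega,\cdot)\in\mathcal{F}^{-}_{1}$ for almost all $\omega$.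 $\mathbb{E}(F_n^{-1}(p))\in\mathbb{R}$ means that this expectation exists and is finite. *)

theory Defs
  imports "HOL-Probability.Probability"
begin

definition is_cdf :: "(real \<Rightarrow> real) \<Rightarrow> bool" where
  "is_cdf F \<longleftrightarrow> (\<exists>\<mu>. real_distribution \<mu> \<and> F = cdf \<mu>)"

(* For a cdf, the value is finite for 0 < u < 1, but may be -\<infinity> at u = 0 and
   \<infinity> (infimum of the empty set) at u = 1. Only 0 \<le> u \<le> 1 is meaningful. *)
definition quantile :: "(real \<Rightarrow> real) \<Rightarrow> real \<Rightarrow> ereal" where
  "quantile F u =
     (if u = 0 then Lim (at_right 0) (\<lambda>v. Inf (ereal ` {x. F x \<ge> v}))
      else Inf (ereal ` {x. F x \<ge> u}))"

(* The quantile function is real valued on {0<..<p} for p < 1, so real_of_ereal loses nothing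
   under the integral. It is bounded above there, so a finite integral means integrability. *)
definition class_F1_minus :: "(real \<Rightarrow> real) set" where
  "class_F1_minus =
     {F. is_cdf F \<and>
         (\<forall>p\<in>{0<..<1}. interval_lebesgue_integrable lborel 0 (ereal p)
                          (\<lambda>u. real_of_ereal (quantile F u)))}"

definition random_cdf :: "'w measure \<Rightarrow> ('w \<Rightarrow> real \<Rightarrow> real) \<Rightarrow> bool" where
  "random_cdf M G \<longleftrightarrow>
     (\<lambda>(\<omega>, x). G \<omega> x) \<in> borel_measurable (M \<Otimes>\<^sub>M borel) \<and>
     (\<forall>\<omega>\<in>space M. \<forall>x. G \<omega> x \<in> {0..1}) \<and>
     (AE \<omega> in M. is_cdf (G \<omega>))"

(* Quantities that make sense only for those \<omega> for which G \<omega> is a cdf are defined almost surely.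
   On the exceptional null set, an infimum over uncountably many x need not be measurable
   with respect to M, so their expectations are taken with respect to the completion of M;
   this makes integrability and expectation independent of the values on null sets. *)
definition has_finite_expectation :: "'w measure \<Rightarrow> ('w \<Rightarrow> real) \<Rightarrow> bool" where
  "has_finite_expectation M X \<longleftrightarrow> integrable (completion M) X"

definition as_expectation :: "'w measure \<Rightarrow> ('w \<Rightarrow> real) \<Rightarrow> real" where
  "as_expectation M X = integral\<^sup>L (completion M) X"

end

theory Submission
  imports Defs
begin

text \<open>
  The integrated quantile is a concave conjugate: \<open>\<integral>\<^sub>0\<^sup>p G\<^sup>-\<^sup>1(u) du\<close> is the maximum over \<open>t\<close> of
  \<open>p t - \<integral>\<^sub>-\<^sub>\<infinity>\<^sup>t G(x) dx\<close>, attained at \<open>t = G\<^sup>-\<^sup>1(p)\<close>. Each of these expressions is affine in \<open>G\<close>, so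
  evaluating the bound for the random cdf at the deterministic point \<open>t = F\<^sup>-\<^sup>1(p)\<close> and taking
  expectations yields the claim. Integrability follows by squeezing between this bound and
  \<open>p F\<^sub>n\<^sup>-\<^sup>1(p)\<close>; measurability comes from the case of equality with the random \<open>t = F\<^sub>n\<^sup>-\<^sup>1(p)\<close>.
\<close>

section \<open>Quantiles as pseudoinverses of cdf's\<close>

abbreviation rquantile :: "(real \<Rightarrow> real) \<Rightarrow> real \<Rightarrow> real" where
  "rquantile G u \<equiv> real_of_ereal (quantile G u)"

lemma is_cdf_mono: "is_cdf G \<Longrightarrow> mono G"
  unfolding is_cdf_def
  by (metis finite_borel_measure.cdf_nondecreasing monoI real_distribution.finite_borel_measure_M)

lemma is_cdf_nonneg: "is_cdf G \<Longrightarrow> 0 \<le> G x"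
  unfolding is_cdf_def
  by (metis finite_borel_measure.cdf_nonneg real_distribution.finite_borel_measure_M)

text \<open>By monotonicity and right continuity, \<open>{x. u \<le> G x}\<close> is a closed
  half-line. Its endpoint is the infimum, so the infimum is real and attained. This Galois
  connection is the only description of the quantile used from here on.\<close>

lemma rquantile_le_iff:
  assumes "is_cdf G" "0 < u" "u < 1"
  shows "rquantile G u \<le> x \<longleftrightarrow> u \<le> G x"
proof -
  obtain \<mu> where "real_distribution \<mu>" and G: "G = cdf \<mu>"
    using assms(1) by (auto simp: is_cdf_def)
  then interpret cdf_distribution \<mu> by (simp add: cdf_distribution_def)
  define q where "q = I u"
  have q: "u \<le> G x \<longleftrightarrow> q \<le> x" for x
    unfolding G q_def by (rule pseudoinverse[OF assms(2,3)])
  have "Inf (ereal ` {q..}) = ereal q"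
    by (rule cInf_eq_minimum) auto
  then have "rquantile G u = q"
    using assms(2) by (simp add: quantile_def q atLeast_def)
  then show ?thesis
    by (simp add: q)
qed

section \<open>The integrated quantile of a fixed cdf\<close>

text \<open>Both sides are the area of the planar region where \<open>0 < u < p\<close>,
  \<open>x < t\<close> and \<open>u \<le> G x\<close>, sliced along \<open>x\<close> on the left and
  along \<open>u\<close> on the right; Tonelli equates them. Since \<open>ennreal\<close> sends
  negative reals to 0, the left integrand is the positive part of the gap.\<close>

lemma nn_integral_quantile_gap:
  assumes G: "is_cdf G" and p: "0 < p" "p < 1"
  shows "(\<integral>\<^sup>+u. ennreal (t - rquantile G u) * indicator {0<..<p} u \<partial>lborel) =
         (\<integral>\<^sup>+x. ennreal (min (G x) p) * indicator {..<t} x \<partial>lborel)"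
proof -
  have [measurable]: "G \<in> borel_measurable borel"
    using is_cdf_mono[OF G] by (rule borel_measurable_mono)
  define k :: "real \<Rightarrow> real \<Rightarrow> ennreal"
    where "k u x = indicator {0<..<p} u * indicator {..<t} x * (if u \<le> G x then 1 else 0)" for u x
  have [measurable]: "case_prod k \<in> borel_measurable (lborel \<Otimes>\<^sub>M lborel)"
    unfolding k_def by measurable
  have left: "(\<integral>\<^sup>+x. k u x \<partial>lborel) = ennreal (t - rquantile G u) * indicator {0<..<p} u" for u
  proof (cases "u \<in> {0<..<p}")
    case True
    \<comment> \<open>The Galois connection turns \<open>u \<le> G x\<close> into a half-line in
      \<open>x\<close>. If \<open>t\<close> lies below the quantile, the slice is empty and the
      truncated gap vanishes too.\<close>
    then have "k u x = indicator {rquantile G u..<t} x" for x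
      using p rquantile_le_iff[OF G, of u x] by (auto simp: k_def split: split_indicator)
    then show ?thesis
      using True by (cases "rquantile G u \<le> t") (simp_all add: ennreal_neg)
  qed (simp add: k_def)
  have right: "(\<integral>\<^sup>+u. k u x \<partial>lborel) = ennreal (min (G x) p) * indicator {..<t} x" for x
  proof (cases "x < t")
    case True
    show ?thesis
    \<comment> \<open>The slice ends at \<open>G x\<close> or at \<open>p\<close>, whichever comes
      first; this is the origin of \<open>min (G x) p\<close>.\<close>
    proof (cases "G x < p")
      case less: True
      then have "k u x = indicator {0<..G x} u" for u
        using True by (auto simp: k_def split: split_indicator)
      then show ?thesis
        using True less is_cdf_nonneg[OF G, of x] by simp
    next
      case False
      then have "k u x = indicator {0<..<p} u" for u
        using True by (auto simp: k_def split: split_indicator)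
      then show ?thesis
        using True False p by (simp add: min_def)
    qed
  qed (simp add: k_def)
  show ?thesis
    using lborel_pair.Fubini'[of k] by (simp add: left right)
qed

lemma
  assumes "G \<in> class_F1_minus" "0 < p" "p < 1"
  shows set_integrable_rquantile: "set_integrable lborel {0<..<p} (rquantile G)"
    and LBINT_rquantile_eq: "(LBINT u=0..ereal p. rquantile G u) = (LBINT u:{0<..<p}. rquantile G u)"
proof -
  have "interval_lebesgue_integrable lborel (ereal 0) (ereal p) (rquantile G)"
    using assms by (auto simp: class_F1_minus_def zero_ereal_def)
  then show "set_integrable lborel {0<..<p} (rquantile G)"
    using assms(2) by (simp add: interval_lebesgue_integrable_def)
  show "(LBINT u=0..ereal p. rquantile G u) = (LBINT u:{0<..<p}. rquantile G u)"
    using assms(2) by (simp add: zero_ereal_def interval_lebesgue_integral_def)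
qed

lemma
  fixes t :: real
  assumes "0 < p" "set_integrable lborel {0<..<p} f"
  shows set_integrable_gap: "set_integrable lborel {0<..<p} (\<lambda>u. t - f u)"
    and LBINT_gap: "(LBINT u:{0<..<p}. t - f u) = p * t - (LBINT u:{0<..<p}. f u)"
proof -
  have c: "set_integrable lborel {0<..<p} (\<lambda>u. t)"
    unfolding set_integrable_def by (simp add: emeasure_lborel_Ioo assms(1) less_imp_le)
  show "set_integrable lborel {0<..<p} (\<lambda>u. t - f u)"
    using c assms(2) by (rule set_integral_diff)
  show "(LBINT u:{0<..<p}. t - f u) = p * t - (LBINT u:{0<..<p}. f u)"
    using set_integral_diff(2)[OF c assms(2)] assms(1) by (simp add: set_lebesgue_integral_def)
qed

text \<open>The left argument is the integral of \<open>t - rquantile G u\<close>. Two losses give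
  the bound: the gap is replaced by its positive part, and the cap \<open>p\<close> on
  \<open>G x\<close> is dropped after the exchange of integrals. A negative left argument is
  truncated to 0, so every \<open>t\<close> is allowed.\<close>

lemma integrated_quantile_ge:
  assumes G: "G \<in> class_F1_minus" and p: "0 < p" "p < 1"
  shows "ennreal (p * t - (LBINT u=0..ereal p. rquantile G u))
         \<le> (\<integral>\<^sup>+x. ennreal (G x) * indicator {..<t} x \<partial>lborel)"
proof -
  have cdf: "is_cdf G"
    using G by (simp add: class_F1_minus_def)
  note gap = set_integrable_gap[OF p(1) set_integrable_rquantile[OF G p], of t, unfolded set_integrable_def]
  have "p * t - (LBINT u=0..ereal p. rquantile G u) = (LBINT u:{0<..<p}. t - rquantile G u)"
    using LBINT_gap[OF p(1) set_integrable_rquantile[OF G p]] by (simp add: LBINT_rquantile_eq[OF G p])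
  also have "\<dots> \<le> (LBINT u. max 0 (indicator {0<..<p} u *\<^sub>R (t - rquantile G u)))"
    unfolding set_lebesgue_integral_def using gap by (intro integral_mono) auto
  finally have "ennreal (p * t - (LBINT u=0..ereal p. rquantile G u))
      \<le> ennreal (LBINT u. max 0 (indicator {0<..<p} u *\<^sub>R (t - rquantile G u)))"
    by (rule ennreal_leI)
  also have "\<dots> = (\<integral>\<^sup>+u. ennreal (max 0 (indicator {0<..<p} u *\<^sub>R (t - rquantile G u))) \<partial>lborel)"
    using gap by (intro nn_integral_eq_integral[symmetric]) auto
  also have "\<dots> = (\<integral>\<^sup>+u. ennreal (t - rquantile G u) * indicator {0<..<p} u \<partial>lborel)"
    by (intro nn_integral_cong) (auto simp: max_def ennreal_neg split: split_indicator)
  also have "\<dots> = (\<integral>\<^sup>+x. ennreal (min (G x) p) * indicator {..<t} x \<partial>lborel)"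
    by (rule nn_integral_quantile_gap[OF cdf p])
  also have "\<dots> \<le> (\<integral>\<^sup>+x. ennreal (G x) * indicator {..<t} x \<partial>lborel)"
    by (intro nn_integral_mono mult_right_mono ennreal_leI) auto
  finally show ?thesis .
qed

text \<open>At \<open>t = rquantile G p\<close> neither loss occurs: \<open>u < p\<close> makes the
  gap non-negative, and \<open>x < t\<close> forces \<open>G x < p\<close>, so the cap is inactive.
  The first claim also shows that \<open>ennreal\<close> truncates nothing in the second.\<close>

lemma
  assumes G: "G \<in> class_F1_minus" and p: "0 < p" "p < 1"
  shows integrated_quantile_le: "(LBINT u=0..ereal p. rquantile G u) \<le> p * rquantile G p"
    and integrated_quantile_eq:
      "(\<integral>\<^sup>+x. ennreal (G x) * indicator {..<rquantile G p} x \<partial>lborel)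
        = ennreal (p * rquantile G p - (LBINT u=0..ereal p. rquantile G u))"
proof -
  let ?q = "rquantile G p"
  have cdf: "is_cdf G"
    using G by (simp add: class_F1_minus_def)
  have le: "rquantile G u \<le> ?q" if "u \<in> {0<..<p}" for u
  proof -
    have "p \<le> G ?q"
      using rquantile_le_iff[OF cdf p, of ?q] by simp
    then show ?thesis
      using that p by (subst rquantile_le_iff[OF cdf]) auto
  qed
  have lt: "G x < p" if "x < ?q" for x
    using rquantile_le_iff[OF cdf p, of x] that by linarith
  note gap = set_integrable_gap[OF p(1) set_integrable_rquantile[OF G p], of ?q, unfolded set_integrable_def]
  have eq: "(LBINT u:{0<..<p}. ?q - rquantile G u) = p * ?q - (LBINT u=0..ereal p. rquantile G u)"
    using LBINT_gap[OF p(1) set_integrable_rquantile[OF G p]] by (simp add: LBINT_rquantile_eq[OF G p])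
  have "0 \<le> (LBINT u:{0<..<p}. ?q - rquantile G u)"
    unfolding set_lebesgue_integral_def using le
    by (intro integral_nonneg_AE AE_I2) (auto split: split_indicator)
  then show "(LBINT u=0..ereal p. rquantile G u) \<le> p * ?q"
    by (simp add: eq)
  have "(\<integral>\<^sup>+x. ennreal (G x) * indicator {..<?q} x \<partial>lborel)
      = (\<integral>\<^sup>+x. ennreal (min (G x) p) * indicator {..<?q} x \<partial>lborel)"
    using lt by (intro nn_integral_cong) (auto simp: min_def not_le split: split_indicator dest: order.asym)
  also have "\<dots> = (\<integral>\<^sup>+u. ennreal (?q - rquantile G u) * indicator {0<..<p} u \<partial>lborel)"
    by (rule nn_integral_quantile_gap[OF cdf p, symmetric])
  also have "\<dots> = (\<integral>\<^sup>+u. ennreal (indicator {0<..<p} u *\<^sub>R (?q - rquantile G u)) \<partial>lborel)"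
    by (intro nn_integral_cong) (auto split: split_indicator)
  also have "\<dots> = ennreal (LBINT u:{0<..<p}. ?q - rquantile G u)"
    unfolding set_lebesgue_integral_def using gap le
    by (intro nn_integral_eq_integral AE_I2) (auto split: split_indicator)
  finally show "(\<integral>\<^sup>+x. ennreal (G x) * indicator {..<?q} x \<partial>lborel)
      = ennreal (p * ?q - (LBINT u=0..ereal p. rquantile G u))"
    by (simp add: eq)
qed

section \<open>Random cdf's and expectations\<close>

text \<open>The preimages of \<open>A\<close> under \<open>f\<close> and \<open>g\<close> differ
  only by subsets of null sets, and these are measurable in the completion.\<close>

lemma measurable_completion_cong_AE:
  assumes g: "g \<in> completion M \<rightarrow>\<^sub>M borel" and eq: "AE x in M. f x = g x"
  shows "f \<in> completion M \<rightarrow>\<^sub>M borel"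
proof (rule measurableI)
  fix A :: "'b set" assume "A \<in> sets borel"
  then have [measurable]: "Measurable.pred (completion M) (\<lambda>x. g x \<in> A)"
    using g by measurable
  have "AE x in M. \<not> (f x \<in> A \<and> g x \<notin> A)" "AE x in M. \<not> (f x \<notin> A \<and> g x \<in> A)"
    using eq by (eventually_elim, simp)+
  note [measurable] = this[THEN sets_completion_AE]
  have "f -` A \<inter> space (completion M) = {x \<in> space (completion M).
      (g x \<in> A \<and> \<not> (f x \<notin> A \<and> g x \<in> A)) \<or> (f x \<in> A \<and> g x \<notin> A)}"
    by auto
  also have "\<dots> \<in> sets (completion M)"
    by measurable
  finally show "f -` A \<inter> space (completion M) \<in> sets (completion M)" .
qed auto

lemma expectation_integrated_quantile:
  fixes M :: "'w measure" and G :: "'w \<Rightarrow> real \<Rightarrow> real"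
  assumes p: "0 < p" "p < 1"
    and F: "F \<in> class_F1_minus"
    and M: "prob_space M"
    and rc: "random_cdf M G"
    and G: "AE \<omega> in M. G \<omega> \<in> class_F1_minus"
    and unbiased: "\<And>x. prob_space.expectation M (\<lambda>\<omega>. G \<omega> x) = F x"
    and X: "has_finite_expectation M (\<lambda>\<omega>. rquantile (G \<omega>) p)"
  shows "has_finite_expectation M (\<lambda>\<omega>. LBINT u=0..ereal p. rquantile (G \<omega>) u)"
    and "(LBINT u=0..ereal p. rquantile F u)
         \<le> as_expectation M (\<lambda>\<omega>. LBINT u=0..ereal p. rquantile (G \<omega>) u)"
proof -
  let ?N = "completion M"
  interpret M: prob_space M by fact
  interpret N: prob_space ?N by (rule M.prob_space_completion)
  interpret MB: pair_sigma_finite M "lborel :: real measure" ..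
  define X where "X \<omega> = rquantile (G \<omega>) p" for \<omega>
  define J where "J \<omega> = (LBINT u=0..ereal p. rquantile (G \<omega>) u)" for \<omega>
  define t where "t = rquantile F p"
  define c where "c = p * t - (LBINT u=0..ereal p. rquantile F u)"
  define K where "K \<omega> = (\<integral>\<^sup>+x. ennreal (G \<omega> x) * indicator {..<t} x \<partial>lborel)" for \<omega>
  define H where "H \<omega> = (\<integral>\<^sup>+x. ennreal (G \<omega> x) * indicator {..<X \<omega>} x \<partial>lborel)" for \<omega>

  have G_meas [measurable]: "case_prod G \<in> borel_measurable (M \<Otimes>\<^sub>M borel)"
    and G01: "\<And>\<omega> x. \<omega> \<in> space M \<Longrightarrow> 0 \<le> G \<omega> x \<and> G \<omega> x \<le> 1"
    using rc by (auto simp: random_cdf_def)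
  \<comment> \<open>\<open>X\<close> is measurable only with respect to the completion, so joint
    measurability of \<open>G\<close> is carried over to \<open>?N\<close> along the
    identity.\<close>
  have "(\<lambda>z. (fst z, snd z)) \<in> ?N \<Otimes>\<^sub>M lborel \<rightarrow>\<^sub>M M \<Otimes>\<^sub>M borel"
    by (intro measurable_Pair measurable_compose[OF measurable_fst] measurable_compose[OF measurable_snd])
      (auto simp: measurable_def)
  from measurable_compose[OF this G_meas]
  have G_meas': "case_prod G \<in> borel_measurable (?N \<Otimes>\<^sub>M lborel)"
    by simp
  have X_int: "integrable ?N X"
    using X unfolding X_def has_finite_expectation_def .
  then have [measurable]: "X \<in> borel_measurable ?N"
    by auto

  have [measurable]: "K \<in> borel_measurable M"
    unfolding K_def by measurable
  \<comment> \<open>As \<open>t\<close> is deterministic, Tonelli brings the expectation inside and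
    unbiasedness replaces \<open>G \<omega> x\<close> by \<open>F x\<close>. Since \<open>t\<close>
    is the maximizer for \<open>F\<close>, the equality case then gives the finite value
    \<open>c\<close>.\<close>
  have "(\<integral>\<^sup>+\<omega>. K \<omega> \<partial>M) = (\<integral>\<^sup>+x. (\<integral>\<^sup>+\<omega>. ennreal (G \<omega> x) * indicator {..<t} x \<partial>M) \<partial>lborel)"
    unfolding K_def by (rule MB.Fubini'[symmetric]) measurable
  also have "\<dots> = (\<integral>\<^sup>+x. ennreal (F x) * indicator {..<t} x \<partial>lborel)"
  proof (rule nn_integral_cong)
    fix x :: real
    have [measurable]: "(\<lambda>\<omega>. G \<omega> x) \<in> borel_measurable M"
      by measurable
    have "integrable M (\<lambda>\<omega>. G \<omega> x)"
      using G01 by (intro M.integrable_const_bound[where B=1] AE_I2) auto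
    then have "(\<integral>\<^sup>+\<omega>. ennreal (G \<omega> x) \<partial>M) = ennreal (F x)"
      using G01 by (subst nn_integral_eq_integral) (auto simp: unbiased)
    then show "(\<integral>\<^sup>+\<omega>. ennreal (G \<omega> x) * indicator {..<t} x \<partial>M) = ennreal (F x) * indicator {..<t} x"
      by (simp add: nn_integral_multc)
  qed
  also have "\<dots> = ennreal c"
    unfolding t_def c_def by (rule integrated_quantile_eq[OF F p])
  finally have K_nn: "(\<integral>\<^sup>+\<omega>. K \<omega> \<partial>M) = ennreal c" .
  have c: "0 \<le> c"
    using integrated_quantile_le[OF F p] by (simp add: c_def t_def)
  \<comment> \<open>A finite mean makes \<open>K\<close> finite almost surely, so
    \<open>enn2real\<close>, which maps infinity to 0, alters it only on a null set.\<close>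
  have K_fin: "AE \<omega> in M. K \<omega> = ennreal (enn2real (K \<omega>))"
    using nn_integral_PInf_AE[of K M] K_nn
    by (auto simp: less_top elim!: eventually_mono)
  have "(\<integral>\<^sup>+\<omega>. ennreal (enn2real (K \<omega>)) \<partial>M) = ennreal c"
    using nn_integral_cong_AE[OF K_fin] K_nn by simp
  then have "has_bochner_integral M (\<lambda>\<omega>. enn2real (K \<omega>)) c"
    using c by (intro has_bochner_integral_nn_integral) auto
  then have K_int: "integrable ?N (\<lambda>\<omega>. enn2real (K \<omega>))" "(\<integral>\<omega>. enn2real (K \<omega>) \<partial>?N) = c"
    by (auto simp: has_bochner_integral_iff integrable_completion integral_completion)

  have lower: "AE \<omega> in ?N. p * t - enn2real (K \<omega>) \<le> J \<omega>"
    using AE_completion[OF G] AE_completion[OF K_fin]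
  proof eventually_elim
    case (elim \<omega>)
    have "ennreal (p * t - J \<omega>) \<le> ennreal (enn2real (K \<omega>))"
      using integrated_quantile_ge[OF elim(1) p, of t] elim(2) unfolding K_def J_def by metis
    then show ?case
      by (simp add: ennreal_le_iff)
  qed
  have upper: "AE \<omega> in ?N. J \<omega> \<le> p * X \<omega>"
    using AE_completion[OF G]
    by eventually_elim (simp add: J_def X_def integrated_quantile_le[OF _ p])

  \<comment> \<open>The cut-off in \<open>H\<close> is random, so the indicator is written as a
    jointly measurable condition on the pair.\<close>
  have "(\<lambda>z. ennreal (case_prod G z) * (if snd z < X (fst z) then 1 else 0))
      \<in> borel_measurable (?N \<Otimes>\<^sub>M lborel)"
    using G_meas' by measurable
  then have "(\<lambda>\<omega>. \<integral>\<^sup>+x. ennreal (G \<omega> x) * (if x < X \<omega> then 1 else 0) \<partial>lborel) \<in> borel_measurable ?N"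
    by (subst (asm) split_beta') (rule lborel.borel_measurable_nn_integral[unfolded split_beta'], simp)
  then have "H \<in> borel_measurable ?N"
    by (simp add: H_def[abs_def] indicator_def of_bool_def)
  then have "(\<lambda>\<omega>. p * X \<omega> - enn2real (H \<omega>)) \<in> borel_measurable ?N"
    by measurable
  \<comment> \<open>The equality case at the random point \<open>X \<omega>\<close> expresses
    \<open>J\<close> through measurable functions, almost surely.\<close>
  moreover have "AE \<omega> in M. J \<omega> = p * X \<omega> - enn2real (H \<omega>)"
    using G
  proof eventually_elim
    case (elim \<omega>)
    show ?case
      using integrated_quantile_eq[OF elim p] integrated_quantile_le[OF elim p]
      by (simp add: H_def X_def J_def)
  qed
  ultimately have J_meas: "J \<in> borel_measurable ?N"
    by (rule measurable_completion_cong_AE)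
  have J_int: "integrable ?N J"
  proof (rule Bochner_Integration.integrable_bound)
    show "integrable ?N (\<lambda>\<omega>. \<bar>p * t - enn2real (K \<omega>)\<bar> + \<bar>p * X \<omega>\<bar>)"
      using K_int(1) X_int by auto
    show "AE \<omega> in ?N. norm (J \<omega>) \<le> norm (\<bar>p * t - enn2real (K \<omega>)\<bar> + \<bar>p * X \<omega>\<bar>)"
      using lower upper by eventually_elim (simp add: abs_if)
  qed (rule J_meas)
  then show "has_finite_expectation M (\<lambda>\<omega>. LBINT u=0..ereal p. rquantile (G \<omega>) u)"
    by (simp add: has_finite_expectation_def J_def[abs_def])
  have "(\<integral>\<omega>. p * t - enn2real (K \<omega>) \<partial>?N) \<le> (\<integral>\<omega>. J \<omega> \<partial>?N)"
    using K_int(1) J_int lower by (intro integral_mono_AE) auto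
  \<comment> \<open>By the choice of \<open>c\<close>, the number \<open>p * t - c\<close> is
    exactly the integrated quantile of \<open>F\<close>.\<close>
  moreover have "(\<integral>\<omega>. p * t - enn2real (K \<omega>) \<partial>?N) = p * t - c"
    using K_int by (simp add: M.prob_space)
  ultimately show "(LBINT u=0..ereal p. rquantile F u)
         \<le> as_expectation M (\<lambda>\<omega>. LBINT u=0..ereal p. rquantile (G \<omega>) u)"
    by (simp add: as_expectation_def c_def J_def[abs_def])
qed

theorem corollary5p2:
  fixes p :: real
    and F :: "real \<Rightarrow> real"
    and M :: "'w measure"
    and Fn :: "nat \<Rightarrow> 'w \<Rightarrow> real \<Rightarrow> real"
  assumes "0 < p" and "p < 1"
    and "F \<in> class_F1_minus"
    and "prob_space M"
    and "\<And>n. n \<ge> 1 \<Longrightarrow> random_cdf M (Fn n)"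
    and "\<And>n. n \<ge> 1 \<Longrightarrow> AE \<omega> in M. Fn n \<omega> \<in> class_F1_minus"
    and "\<And>n x. n \<ge> 1 \<Longrightarrow> prob_space.expectation M (\<lambda>\<omega>. Fn n \<omega> x) = F x"
    and "\<And>n. n \<ge> 1 \<Longrightarrow>
           has_finite_expectation M (\<lambda>\<omega>. real_of_ereal (quantile (Fn n \<omega>) p))"
  shows "\<forall>n\<ge>1.
           has_finite_expectation M
             (\<lambda>\<omega>. LBINT u=0..ereal p. real_of_ereal (quantile (Fn n \<omega>) u)) \<and>
           as_expectation M
             (\<lambda>\<omega>. LBINT u=0..ereal p. real_of_ereal (quantile (Fn n \<omega>) u))
           - (LBINT u=0..ereal p. real_of_ereal (quantile F u)) \<ge> 0"
proof (intro allI impI)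
  fix n :: nat
  assume n: "n \<ge> 1"
  note E = expectation_integrated_quantile[where G = "Fn n", OF assms(1-4) assms(5)[OF n] assms(6)[OF n] assms(7)[OF n] assms(8)[OF n]]
  show "has_finite_expectation M
          (\<lambda>\<omega>. LBINT u=0..ereal p. real_of_ereal (quantile (Fn n \<omega>) u)) \<and>
        as_expectation M
          (\<lambda>\<omega>. LBINT u=0..ereal p. real_of_ereal (quantile (Fn n \<omega>) u))
        - (LBINT u=0..ereal p. real_of_ereal (quantile F u)) \<ge> 0"
    using E by simp
qed

end
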